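(* For all integers $n\ge 0$, $$F_{n+1}^2=C_n+\sum_{k=2}^nF^2_{k-1}C_{n-k}+\sum_{k=3}^n\sum_{l=3}^k(2-\delta_{l,3})F^2_{k-l+1}C_{n-k},$$ where $C_n$ is the number of ways to tile an $n$-board using half-squares and $(\frac12,\frac12)$-fences such that no bifences occur.
   Context: The Fibonacci numbers are $F_0=0$, $F_1=1$, $F_n=F_{n-1}+F_{n-2}$ for $n\ge2$. $\delta_{i,j}$ is $1$ if $i=j$ and $0$ otherwise. Empty sums are $0$. An $n$-board is a $1\times n$ array of $n$ unit square cells in a row (horizontal extent $[0,n]$). A half-square is a tile of width $\frac12$ and height $1$, covering a horizontal interval $[x,x+\frac12]$. A $(\frac12,\frac12)$-fence is a single tile composed of two pieces (posts), each of width $\frac12$ and height $1$, separated by a gap of width $\frac12$; it covers $[x,x+\frac12]\cup[x+1,x+\frac32]$ for some $x$. Tiles are not rotated. Tiles need not be aligned with the cell boundaries, and the gap of a fence must be covered by other tiles. A tiling covers the board exactly, with no overlaps (of interiors), no uncovered region and nothing protruding from the board. There is exactly one (empty) tiling of the $0$-board. A bifence is a pair of interlocking fences, i.e. fences starting at $x$ and $x+\frac12$, together covering exactly $[x,x+2]$ (here $x$ need not be an integer). The numbers $C_n$ satisfy $C_0=C_1=1$, $C_2=3$ and $C_n=C_{n-1}+2C_{n-2}+C_{n-3}$ for $n\ge3$. *)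

theory Defs
  imports "HOL-Analysis.Analysis" "HOL-Number_Theory.Fib"
begin

text \<open>
  The board and all tiles have height 1 and tiles are not rotated, so a placed tile is given by
  its kind and the (arbitrary real) abscissa of its left edge, and regions are represented by
  their horizontal extents.
\<close>

datatype tile = Half_Square real | Fence real

fun region :: "tile \<Rightarrow> real set" where
  "region (Half_Square x) = {x .. x + 1/2}"
| "region (Fence x) = {x .. x + 1/2} \<union> {x + 1 .. x + 3/2}"

text \<open>
  As a union of cells, the 0-board is empty (rather than the degenerate interval from 0 to 0),
  so that its only tiling is the empty one.
\<close>

definition board :: "nat \<Rightarrow> real set" where
  "board n = (\<Union>i<n. {real i .. real i + 1})"

definition is_tiling :: "nat \<Rightarrow> tile set \<Rightarrow> bool" where
  "is_tiling n T \<longleftrightarrow>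
     finite T \<and>
     (\<forall>s\<in>T. \<forall>t\<in>T. s \<noteq> t \<longrightarrow> interior (region s) \<inter> interior (region t) = {}) \<and>
     (\<Union>t\<in>T. region t) = board n"

definition has_bifence :: "tile set \<Rightarrow> bool" where
  "has_bifence T \<longleftrightarrow> (\<exists>x. Fence x \<in> T \<and> Fence (x + 1/2) \<in> T)"

definition C :: "nat \<Rightarrow> nat" where
  "C n = card {T. is_tiling n T \<and> \<not> has_bifence T}"

end

theory Submission
  imports Defs
begin

text \<open>
  Measured in half cells, a bifence-free tiling decomposes uniquely into half-squares (length 1)
  and fences whose gap holds a half-square (length 3), so \<open>C n\<close> is the term of index \<open>2 * n\<close> of
  the sequence \<open>a (m + 3) = a (m + 2) + a m\<close>. Peeling off the rightmost tile gives this without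
  first proving that all tiles are aligned to the half-integer grid. The identity then follows
  by induction, since both sides satisfy the same linear recurrence.
\<close>

subsection \<open>Tilings of arbitrary regions\<close>

text \<open>The conditions of \<open>is_tiling\<close> for an arbitrary region: removing a fence but
  not the half-square in its gap can leave a region with a hole.\<close>

definition tiles :: "real set \<Rightarrow> tile set \<Rightarrow> bool" where
  "tiles B T \<longleftrightarrow>
     finite T \<and>
     (\<forall>s\<in>T. \<forall>t\<in>T. s \<noteq> t \<longrightarrow> interior (region s) \<inter> interior (region t) = {}) \<and>
     (\<Union>t\<in>T. region t) = B"

text \<open>Removing a tile leaves a cover known at first only up to boundary points; for regular
  closed regions these are recovered by taking closures of interiors.\<close>

definition regular_closed :: "'a::topological_space set \<Rightarrow> bool" where
  "regular_closed S \<longleftrightarrow> closure (interior S) = S"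

lemma regular_closed_empty: "regular_closed {}"
  by (simp add: regular_closed_def)

lemma regular_closed_atLeastAtMost: "a < b \<Longrightarrow> regular_closed {a..b::real}"
  by (simp add: regular_closed_def interior_atLeastAtMost_real)

lemma regular_closed_imp_closed: "regular_closed S \<Longrightarrow> closed S"
  by (metis closed_closure regular_closed_def)

lemma regular_closed_Un:
  assumes "regular_closed S" "regular_closed T"
  shows "regular_closed (S \<union> T)"
proof -
  have "S \<union> T = closure (interior S \<union> interior T)"
    using assms by (simp add: regular_closed_def)
  also have "\<dots> \<subseteq> closure (interior (S \<union> T))"
    by (intro closure_mono) (simp add: interior_mono)
  finally have "S \<union> T \<subseteq> closure (interior (S \<union> T))" .
  moreover have "closure (interior (S \<union> T)) \<subseteq> S \<union> T"
    using assms by (intro closure_minimal interior_subset closed_Un regular_closed_imp_closed)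
  ultimately show ?thesis by (auto simp: regular_closed_def)
qed

lemma regular_closed_region: "regular_closed (region t)"
  by (cases t) (auto intro!: regular_closed_Un regular_closed_atLeastAtMost)

text \<open>An open set that misses a set also misses its closure, here the closure of
  \<open>interior S\<close>.\<close>

lemma open_disjoint_regular_closed:
  assumes "open U" "regular_closed S" "U \<inter> interior S = {}"
  shows "U \<inter> S = {}"
  using assms by (metis open_Int_closure_eq_empty regular_closed_def)

section \<open>Inserting and removing a tile\<close>

lemma tiles_subset: "tiles B T \<Longrightarrow> t \<in> T \<Longrightarrow> region t \<subseteq> B"
  by (auto simp: tiles_def)

lemma tiles_empty: "tiles {} T \<longleftrightarrow> T = {}"
proof -
  have "region t \<noteq> {}" for t by (cases t) auto
  then show ?thesis by (auto simp: tiles_def)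
qed

lemma interior_region_nonempty: "interior (region t) \<noteq> {}"
proof
  assume "interior (region t) = {}"
  then have "region t = {}" using regular_closed_region[of t] by (simp add: regular_closed_def)
  then show False by (cases t) auto
qed

text \<open>The finite overlap allows shared boundary points. From left to right, the other tiles
  cover \<open>interior B\<close>, and their union is closed, so they cover \<open>B\<close>; each
  of them has its interior in \<open>B\<close>, hence lies in \<open>B\<close>.\<close>

lemma tiles_insert:
  assumes t: "t \<notin> T" and B: "regular_closed B" and fin: "finite (region t \<inter> B)"
  shows "tiles (region t \<union> B) (insert t T) \<longleftrightarrow> tiles B T"
proof -
  \<comment> \<open>A finite set of reals has empty interior, and interiors commute with
    intersection.\<close>
  have dis: "interior (region t) \<inter> interior B = {}"
    using empty_interior_finite[OF fin] by simp
  show ?thesis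
  proof
    assume L: "tiles (region t \<union> B) (insert t T)"
    have un: "region t \<union> (\<Union>s\<in>T. region s) = region t \<union> B"
      using L by (auto simp: tiles_def)
    have "interior B \<inter> region t = {}"
      by (rule open_disjoint_regular_closed) (use dis regular_closed_region in auto)
    then have "interior B \<subseteq> (\<Union>s\<in>T. region s)"
      using un interior_subset[of B] by blast
    moreover have "closed (\<Union>s\<in>T. region s)"
      using L by (auto simp: tiles_def intro!: closed_UN regular_closed_imp_closed[OF regular_closed_region])
    ultimately have "closure (interior B) \<subseteq> (\<Union>s\<in>T. region s)"
      by (rule closure_minimal)
    then have 1: "B \<subseteq> (\<Union>s\<in>T. region s)" using B by (simp add: regular_closed_def)
    have 2: "region s \<subseteq> B" if "s \<in> T" for s
    proof -
      have "interior (region s) \<inter> interior (region t) = {}"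
        using L that t by (auto simp: tiles_def)
      then have "interior (region s) \<inter> region t = {}"
        by (rule open_disjoint_regular_closed[OF open_interior regular_closed_region])
      then have "interior (region s) \<subseteq> B"
        using un interior_subset[of "region s"] that by blast
      then have "closure (interior (region s)) \<subseteq> B"
        by (intro closure_minimal regular_closed_imp_closed B)
      then show ?thesis using regular_closed_region[of s] by (simp add: regular_closed_def)
    qed
    show "tiles B T" using 1 2 L by (auto simp: tiles_def)
  next
    assume R: "tiles B T"
    have "interior (region s) \<inter> interior (region t) = {}" if "s \<in> T" for s
      using interior_mono[OF tiles_subset[OF R that]] dis by blast
    then show "tiles (region t \<union> B) (insert t T)"
      using R by (auto simp: tiles_def)
  qed
qed

lemma tiles_remove:
  assumes "tiles (region t \<union> B) T" "t \<in> T" "regular_closed B" "finite (region t \<inter> B)"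
  shows "tiles B (T - {t})"
  using tiles_insert[of t "T - {t}" B] assms by (simp add: insert_absorb)

text \<open>A tile of \<open>T\<close> lies in \<open>B\<close>, so its whole region would be finite
  although it has nonempty interior.\<close>

lemma tiles_notin:
  assumes "tiles B T" "finite (region t \<inter> B)"
  shows "t \<notin> T"
proof
  assume "t \<in> T"
  then have "region t \<inter> B = region t" using tiles_subset[OF assms(1)] by blast
  with assms(2) show False using empty_interior_finite interior_region_nonempty by metis
qed

subsection \<open>Bifence-free tilings of boards of half-integer length\<close>

text \<open>Length is counted in half cells, odd lengths included because peeling off tiles passes
  through them. As with \<open>board\<close>, length 0 gives the empty set and not a single
  point.\<close>

definition half_board :: "nat \<Rightarrow> real set" where
  "half_board m = (if m = 0 then {} else {0 .. real m / 2})"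

definition bifence_free :: "nat \<Rightarrow> tile set set" where
  "bifence_free m = {T. tiles (half_board m) T \<and> \<not> has_bifence T}"

lemma regular_closed_half_board: "regular_closed (half_board m)"
  by (simp add: half_board_def regular_closed_empty regular_closed_atLeastAtMost)

lemma board_eq_half_board: "board n = half_board (2 * n)"
proof (induction n)
  case 0
  show ?case by (simp add: board_def half_board_def)
next
  case (Suc n)
  have "board (Suc n) = {real n..real n + 1} \<union> board n"
    by (simp add: board_def lessThan_Suc)
  then show ?case using Suc by (auto simp: half_board_def)
qed

lemma C_eq_card: "C n = card (bifence_free (2 * n))"
  by (simp add: C_def bifence_free_def is_tiling_def tiles_def board_eq_half_board)

section \<open>The rightmost tile and the gap of a fence\<close>

lemma half_board_Suc:
  "half_board (Suc m) = region (Half_Square (real m / 2)) \<union> half_board m"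
  by (auto simp: half_board_def field_simps)

lemma finite_inter_half_board:
  "finite (region (Half_Square (real m / 2)) \<inter> half_board m)"
  by (rule finite_subset[of _ "{real m / 2}"]) (auto simp: half_board_def)

text \<open>Of the last three half cells, the posts of the fence take the first and third, and the
  half-square fills the second.\<close>

lemma half_board_fence:
  "half_board (m + 3) = region (Fence (real m / 2)) \<union>
     (region (Half_Square (real (m + 1) / 2)) \<union> half_board m)"
  by (auto simp: half_board_def field_simps)

lemma finite_fence_inter:
  "finite (region (Fence (real m / 2)) \<inter>
     (region (Half_Square (real (m + 1) / 2)) \<union> half_board m))"
  \<comment> \<open>Contact is possible only at the end of the shorter board and at the two ends of
    the gap.\<close>
  by (rule finite_subset[of _ "{real m / 2, real m / 2 + 1/2, real m / 2 + 1}"])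
    (auto simp: half_board_def field_simps)

lemma finite_gap_inter:
  "finite (region (Half_Square (real (m + 1) / 2)) \<inter> half_board m)"
  \<comment> \<open>The left post separates the gap from the shorter board, so not even a boundary
    point is shared.\<close>
  by (rule finite_subset[of _ "{}"]) (auto simp: half_board_def field_simps)

text \<open>Some tile contains the right end of the board and cannot protrude, so its right edge is
  there; this fixes its real position.\<close>

lemma rightmost_tile:
  assumes T: "tiles (half_board (Suc m)) T"
  shows "Half_Square (real m / 2) \<in> T \<or> (m \<ge> 2 \<and> Fence (real (m - 2) / 2) \<in> T)"
proof -
  have "real (Suc m) / 2 \<in> half_board (Suc m)" by (simp add: half_board_def)
  then obtain t where t: "t \<in> T" "real (Suc m) / 2 \<in> region t"
    using T unfolding tiles_def by blast
  have sub: "region t \<subseteq> {0 .. real (Suc m) / 2}"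
    using tiles_subset[OF T t(1)] by (simp add: half_board_def)
  show ?thesis
  proof (cases t)
    case (Half_Square x)
    have "x + 1/2 \<in> region t" by (simp add: Half_Square)
    with sub have "x + 1/2 \<le> real (Suc m) / 2" by (meson atLeastAtMost_iff subsetD)
    with t Half_Square have "x = real m / 2" by auto
    with t Half_Square show ?thesis by simp
  next
    case (Fence x)
    have "x + 3/2 \<in> region t" "x \<in> region t" by (simp_all add: Fence)
    with sub have x: "x + 3/2 \<le> real (Suc m) / 2" "0 \<le> x" by (meson atLeastAtMost_iff subsetD)+
    with t Fence have x_eq: "x = (real m - 2) / 2" by auto
    \<comment> \<open>The left edge is nonnegative, which makes the truncated subtraction
      \<open>m - 2\<close> exact.\<close>
    with x have "m \<ge> 2" by simp
    moreover from this have "x = real (m - 2) / 2" by (simp add: x_eq of_nat_diff)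
    ultimately show ?thesis using t Fence by blast
  qed
qed

text \<open>Without the fence, the rightmost point of the remaining region is the right end of the
  gap. The tile covering that point must end there, and a fence in this place would form a
  bifence.\<close>

lemma fence_gap:
  assumes T: "tiles (half_board (m + 3)) T" and nb: "\<not> has_bifence T"
    and f: "Fence (real m / 2) \<in> T"
  shows "Half_Square (real (m + 1) / 2) \<in> T"
proof -
  let ?r = "real m / 2"
  let ?B = "region (Half_Square (real (m + 1) / 2)) \<union> half_board m"
  have B: "tiles ?B (T - {Fence ?r})"
    using T f finite_fence_inter unfolding half_board_fence
    by (intro tiles_remove regular_closed_Un regular_closed_region regular_closed_half_board)
  have le: "z \<le> ?r + 1" if "z \<in> ?B" for z
    using that by (auto simp: half_board_def field_simps split: if_splits)
  have "?r + 1 \<in> ?B" by (simp add: field_simps)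
  then obtain t where t: "t \<in> T" "?r + 1 \<in> region t" and tn: "t \<noteq> Fence ?r"
    using B unfolding tiles_def by blast
  have sub: "region t \<subseteq> ?B" using tiles_subset[OF B] t tn by blast
  show ?thesis
  proof (cases t)
    case (Half_Square x)
    have "x + 1/2 \<in> region t" by (simp add: Half_Square)
    with sub le have "x + 1/2 \<le> ?r + 1" by blast
    with t Half_Square have "x = real (m + 1) / 2" by (auto simp: field_simps)
    with t Half_Square show ?thesis by simp
  next
    case (Fence x)
    have "x + 3/2 \<in> region t" by (simp add: Fence)
    with sub le have "x + 3/2 \<le> ?r + 1" by blast
    \<comment> \<open>Ending at \<open>?r + 1\<close>, this fence starts half a cell before the
      given one.\<close>
    with t Fence have "?r = x + 1/2" by auto
    with t Fence f nb show ?thesis unfolding has_bifence_def by metis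
  qed
qed

section \<open>Appending and peeling off a half-square or a filled fence\<close>

lemma has_bifence_mono: "has_bifence S \<Longrightarrow> S \<subseteq> T \<Longrightarrow> has_bifence T"
  by (auto simp: has_bifence_def)

definition add_square :: "nat \<Rightarrow> tile set \<Rightarrow> tile set" where
  "add_square m = insert (Half_Square (real m / 2))"

text \<open>A fence with filled gap acts as one block of three half cells.\<close>

definition add_fence :: "nat \<Rightarrow> tile set \<Rightarrow> tile set" where
  "add_fence m T = insert (Fence (real m / 2)) (insert (Half_Square (real (m + 1) / 2)) T)"

lemma square_notin: "T \<in> bifence_free m \<Longrightarrow> Half_Square (real m / 2) \<notin> T"
  using tiles_notin finite_inter_half_board by (auto simp: bifence_free_def)

lemma gap_square_notin: "T \<in> bifence_free m \<Longrightarrow> Half_Square (real (m + 1) / 2) \<notin> T"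
  using tiles_notin finite_gap_inter unfolding bifence_free_def by blast

text \<open>Shows that an appended fence is new, that it interlocks with no older fence, and that
  the two ways of appending give different tilings.\<close>

lemma fence_bound:
  assumes "T \<in> bifence_free m" "Fence x \<in> T"
  shows "x + 3/2 \<le> real m / 2"
proof -
  have "x + 3/2 \<in> region (Fence x)" by simp
  then have "x + 3/2 \<in> half_board m"
    using assms tiles_subset unfolding bifence_free_def by blast
  then show ?thesis by (auto simp: half_board_def split: if_splits)
qed

lemma add_square_bifence_free:
  assumes T: "T \<in> bifence_free m"
  shows "add_square m T \<in> bifence_free (Suc m)"
proof -
  have "tiles (half_board (Suc m)) (add_square m T)"
    unfolding half_board_Suc add_square_def
    using tiles_insert[OF square_notin[OF T] regular_closed_half_board finite_inter_half_board] T
    by (simp add: bifence_free_def)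
  moreover have "\<not> has_bifence (add_square m T)"
    using T by (auto simp: add_square_def bifence_free_def has_bifence_def)
  ultimately show ?thesis by (simp add: bifence_free_def)
qed

lemma add_fence_bifence_free:
  assumes T: "T \<in> bifence_free m"
  shows "add_fence m T \<in> bifence_free (m + 3)"
proof -
  let ?h = "Half_Square (real (m + 1) / 2)"
  have 1: "tiles (region ?h \<union> half_board m) (insert ?h T)"
    using tiles_insert[OF gap_square_notin[OF T] regular_closed_half_board finite_gap_inter] T
    by (simp add: bifence_free_def)
  have "Fence (real m / 2) \<notin> insert ?h T"
    by (rule tiles_notin[OF 1 finite_fence_inter])
  from tiles_insert[OF this _ finite_fence_inter] 1
  have "tiles (half_board (m + 3)) (add_fence m T)"
    unfolding half_board_fence add_fence_def
    by (metis regular_closed_Un regular_closed_region regular_closed_half_board)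
  \<comment> \<open>Older fences start at least 3/2 before the new one; interlocking needs a
    distance of 1/2.\<close>
  moreover have "\<not> has_bifence (add_fence m T)"
    using T fence_bound[OF T] by (force simp: add_fence_def bifence_free_def has_bifence_def)
  ultimately show ?thesis by (simp add: bifence_free_def)
qed

text \<open>Undoes the two ways of appending: peel off the rightmost tile and, if it is a fence,
  also the half-square that \<open>fence_gap\<close> puts in its gap.\<close>

lemma bifence_free_cases:
  assumes T: "T \<in> bifence_free (Suc m)"
  shows "T \<in> add_square m ` bifence_free m \<or>
    (m \<ge> 2 \<and> T \<in> add_fence (m - 2) ` bifence_free (m - 2))"
proof -
  have tl: "tiles (half_board (Suc m)) T" and nb: "\<not> has_bifence T"
    using T by (auto simp: bifence_free_def)
  from rightmost_tile[OF tl] show ?thesis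
  proof
    let ?h = "Half_Square (real m / 2)"
    assume h: "?h \<in> T"
    have "tiles (half_board m) (T - {?h})"
      using tl h unfolding half_board_Suc
      by (intro tiles_remove regular_closed_half_board finite_inter_half_board)
    then have "T - {?h} \<in> bifence_free m"
      using nb has_bifence_mono by (auto simp: bifence_free_def)
    moreover have "T = add_square m (T - {?h})" using h by (auto simp: add_square_def)
    ultimately show ?thesis by blast
  next
    assume f: "m \<ge> 2 \<and> Fence (real (m - 2) / 2) \<in> T"
    define k where "k = m - 2"
    have m: "Suc m = k + 3" using f by (simp add: k_def)
    let ?f = "Fence (real k / 2)" and ?h = "Half_Square (real (k + 1) / 2)"
    have fT: "?f \<in> T" using f unfolding k_def by blast
    have tl': "tiles (half_board (k + 3)) T" using tl m by simp
    have hT: "?h \<in> T" by (rule fence_gap[OF tl' nb fT])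
    have "tiles (region ?h \<union> half_board k) (T - {?f})"
      using tl' fT unfolding half_board_fence
      by (intro tiles_remove regular_closed_Un regular_closed_region regular_closed_half_board
          finite_fence_inter)
    then have "tiles (half_board k) (T - {?f} - {?h})"
      by (rule tiles_remove[OF _ _ regular_closed_half_board finite_gap_inter]) (use hT in auto)
    then have "T - {?f} - {?h} \<in> bifence_free k"
      using nb has_bifence_mono by (auto simp: bifence_free_def)
    moreover have "T = add_fence k (T - {?f} - {?h})"
      using fT hT by (auto simp: add_fence_def)
    ultimately show ?thesis using f unfolding k_def by blast
  qed
qed

section \<open>Counting bifence-free tilings\<close>

lemma bifence_free_0: "bifence_free 0 = {{}}"
  by (auto simp: bifence_free_def half_board_def tiles_empty has_bifence_def)

text \<open>At most two half cells leave no room for a fence.\<close>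

lemma bifence_free_Suc:
  "m < 2 \<Longrightarrow> bifence_free (Suc m) = add_square m ` bifence_free m"
  using bifence_free_cases add_square_bifence_free by fastforce

lemma bifence_free_add_3:
  "bifence_free (m + 3) = add_square (m + 2) ` bifence_free (m + 2) \<union> add_fence m ` bifence_free m"
  (is "?L = ?R")
proof
  show "?L \<subseteq> ?R"
    using bifence_free_cases[of _ "m + 2"] by (auto simp: numeral_3_eq_3)
  show "?R \<subseteq> ?L"
    using add_square_bifence_free[of _ "m + 2"] add_fence_bifence_free[of _ m]
    by (auto simp: numeral_3_eq_3)
qed

lemma inj_add_square: "inj_on (add_square m) (bifence_free m)"
  unfolding add_square_def
  by (intro inj_onI) (metis insert_ident square_notin)

text \<open>The two added tiles are distinct and absent from the old tilings, so they
  cancel.\<close>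

lemma inj_add_fence: "inj_on (add_fence m) (bifence_free m)"
proof (rule inj_onI)
  fix S T assume S: "S \<in> bifence_free m" and T: "T \<in> bifence_free m"
    and eq: "add_fence m S = add_fence m T"
  have "Fence (real m / 2) \<notin> S" "Fence (real m / 2) \<notin> T"
    using fence_bound S T by force+
  then show "S = T"
    using gap_square_notin[OF S] gap_square_notin[OF T] eq
    unfolding add_fence_def by (metis insert_iff insert_ident tile.distinct(1))
qed

text \<open>Tile positions are real, so finiteness is obtained by induction through peeling.\<close>

lemma finite_bifence_free: "finite (bifence_free m)"
proof (induction m rule: less_induct)
  case (less m)
  show ?case
  proof (cases m)
    case 0
    then show ?thesis by (simp add: bifence_free_0)
  next
    case (Suc k)
    \<comment> \<open>For \<open>k < 2\<close> truncation gives index 0 in the second image, which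
      merely enlarges the right side.\<close>
    have "bifence_free (Suc k) \<subseteq>
        add_square k ` bifence_free k \<union> add_fence (k - 2) ` bifence_free (k - 2)"
      using bifence_free_cases by blast
    then show ?thesis
      unfolding Suc using less[of k] less[of "k - 2"] Suc by (auto intro: finite_subset)
  qed
qed

lemma card_bifence_free_Suc:
  "m < 2 \<Longrightarrow> card (bifence_free (Suc m)) = card (bifence_free m)"
  by (simp add: bifence_free_Suc card_image inj_add_square)

lemma card_bifence_free_add_3:
  "card (bifence_free (m + 3)) = card (bifence_free (m + 2)) + card (bifence_free m)"
proof -
  have "add_square (m + 2) S \<noteq> add_fence m T"
    if S: "S \<in> bifence_free (m + 2)" and T: "T \<in> bifence_free m" for S T
  proof
    assume "add_square (m + 2) S = add_fence m T"
    \<comment> \<open>This fence would end at \<open>m / 2 + 3/2\<close>, beyond the end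
      \<open>m / 2 + 1\<close> of the board of \<open>S\<close>.\<close>
    then have "Fence (real m / 2) \<in> S"
      by (auto simp: add_square_def add_fence_def)
    from fence_bound[OF S this] show False by simp
  qed
  then have "add_square (m + 2) ` bifence_free (m + 2) \<inter> add_fence m ` bifence_free m = {}"
    by blast
  then show ?thesis
    unfolding bifence_free_add_3
    by (simp add: card_Un_disjoint finite_bifence_free card_image inj_add_square inj_add_fence)
qed

lemma card_bifence_free_small:
  "card (bifence_free 0) = 1" "card (bifence_free 1) = 1" "card (bifence_free 2) = 1"
  using card_bifence_free_Suc[of 0] card_bifence_free_Suc[of 1]
  by (simp_all add: bifence_free_0 numeral_2_eq_2)

subsection \<open>The recurrence and the Fibonacci identity\<close>

lemma C_0: "C 0 = 1" and C_1: "C 1 = 1" and C_2: "C 2 = 3"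
  using card_bifence_free_add_3[of 0] card_bifence_free_add_3[of 1] card_bifence_free_small
  by (simp_all add: C_eq_card eval_nat_numeral)

text \<open>Three instances of the recurrence in half cells eliminate the odd lengths:
  \<open>?a 6 = ?a 4 + 2 * ?a 2 + ?a 0\<close>.\<close>

lemma C_rec: "C (n + 3) = C (n + 2) + 2 * C (n + 1) + C n"
proof -
  let ?a = "\<lambda>j. card (bifence_free (2 * n + j))"
  have "?a 6 = ?a 5 + ?a 3" "?a 5 = ?a 4 + ?a 2" "?a 3 = ?a 2 + ?a 0"
    using card_bifence_free_add_3[of "2 * n + 3"] card_bifence_free_add_3[of "2 * n + 2"]
      card_bifence_free_add_3[of "2 * n"] by (simp_all only: add.assoc) simp_all
  moreover have "2 * (n + 3) = 2 * n + 6" "2 * (n + 2) = 2 * n + 4" "2 * (n + 1) = 2 * n + 2"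
    by simp_all
  ultimately show ?thesis unfolding C_eq_card by (simp add: eval_nat_numeral)
qed

text \<open>Closed form of the total coefficient of \<open>C (n - k)\<close> in the two sums, for
  \<open>k = j + 2\<close>; integer-valued because of the subtraction.\<close>

definition fib_weight :: "nat \<Rightarrow> int" where
  "fib_weight j = int (fib (j + 1)) ^ 2 + 2 * int (fib j) * int (fib (j + 1)) - int (fib j) ^ 2"

lemma sum_fib_squares: "(\<Sum>i=1..j. int (fib i) ^ 2) = int (fib j) * int (fib (j + 1))"
  by (induction j) (auto simp: algebra_simps power2_eq_square)

lemma sum_eq_fib_weight:
  "int (fib (j + 1)) ^ 2
     + (\<Sum>l = 3..j + 2. (2 - (if l = 3 then 1 else 0)) * int (fib (j + 2 - l + 1)) ^ 2)
   = fib_weight j"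
proof -
  \<comment> \<open>Substituting \<open>i = j + 3 - l\<close> sends \<open>l = 3\<close> to
    \<open>i = j\<close>, so the delta removes one copy of the last square.\<close>
  have "(\<Sum>l = 3..j + 2. (2 - (if l = 3 then 1 else 0)) * int (fib (j + 2 - l + 1)) ^ 2)
      = (\<Sum>i = 1..j. (2 - (if i = j then 1 else 0)) * int (fib i) ^ 2)"
    by (rule sum.reindex_bij_witness[of _ "\<lambda>i. j + 3 - i" "\<lambda>l. j + 3 - l"])
      (auto simp: Suc_diff_le eval_nat_numeral)
  also have "\<dots> = 2 * (\<Sum>i = 1..j. int (fib i) ^ 2) - (\<Sum>i = 1..j. if i = j then int (fib i) ^ 2 else 0)"
    unfolding sum_distrib_left sum_subtractf[symmetric] by (rule sum.cong) auto
  \<comment> \<open>For \<open>j = 0\<close> the sum is empty, in agreement with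
    \<open>fib 0 = 0\<close>.\<close>
  also have "(\<Sum>i = 1..j. if i = j then int (fib i) ^ 2 else 0) = int (fib j) ^ 2"
    by (cases j) (auto simp: sum.delta)
  finally show ?thesis unfolding sum_fib_squares fib_weight_def by linarith
qed

text \<open>The values 1, 1, 3 are those the recurrence yields when \<open>c\<close> is extended by
  0 to negative indices, so convolving with \<open>g\<close> adds just the term
  \<open>g (m + 3)\<close>.\<close>

lemma convolution_rec:
  fixes g c :: "nat \<Rightarrow> int"
  assumes "c 0 = 1" "c 1 = 1" "c 2 = 3"
    and rec: "\<And>n. c (n + 3) = c (n + 2) + 2 * c (n + 1) + c n"
  defines "S \<equiv> \<lambda>m. \<Sum>j\<le>m. g j * c (m - j)"
  shows "S (m + 3) = S (m + 2) + 2 * S (m + 1) + S m + g (m + 3)"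
proof -
  have "(\<Sum>j\<le>m. g j * c (m + 3 - j))
      = (\<Sum>j\<le>m. g j * c (m + 2 - j) + 2 * (g j * c (m + 1 - j)) + g j * c (m - j))"
  proof (rule sum.cong)
    fix j assume "j \<in> {..m}"
    then have "m + 3 - j = (m - j) + 3" "m + 2 - j = (m - j) + 2" "m + 1 - j = (m - j) + 1"
      by auto
    then show "g j * c (m + 3 - j)
        = g j * c (m + 2 - j) + 2 * (g j * c (m + 1 - j)) + g j * c (m - j)"
      by (simp only: rec) (simp add: algebra_simps)
  qed simp
  also have "\<dots> = (\<Sum>j\<le>m. g j * c (m + 2 - j)) + 2 * (\<Sum>j\<le>m. g j * c (m + 1 - j)) + S m"
    by (simp add: sum.distrib sum_distrib_left S_def)
  finally have *: "(\<Sum>j\<le>m. g j * c (m + 3 - j))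
      = (\<Sum>j\<le>m. g j * c (m + 2 - j)) + 2 * (\<Sum>j\<le>m. g j * c (m + 1 - j)) + S m" .
  \<comment> \<open>The terms with \<open>j > m\<close> are split off; the coefficient 3 of
    \<open>g (m + 1)\<close> is 1 from \<open>S (m + 2)\<close> plus 2 from
    \<open>2 * S (m + 1)\<close>.\<close>
  have "S (m + 3) = (\<Sum>j\<le>m. g j * c (m + 3 - j)) + 3 * g (m + 1) + g (m + 2) + g (m + 3)"
    using assms(1-3) by (simp add: S_def numeral_3_eq_3 numeral_2_eq_2)
  moreover have "S (m + 2) = (\<Sum>j\<le>m. g j * c (m + 2 - j)) + g (m + 1) + g (m + 2)"
    using assms(1-3) by (simp add: S_def numeral_2_eq_2)
  moreover have "S (m + 1) = (\<Sum>j\<le>m. g j * c (m + 1 - j)) + g (m + 1)"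
    using assms(1-3) by (simp add: S_def)
  ultimately show ?thesis using * by simp
qed

text \<open>The identity for \<open>n = m + 2\<close> with the sums merged. Both sides satisfy the
  recurrence of \<open>C\<close> with the extra term \<open>fib_weight (m + 3)\<close>; its order
  three calls for three base cases.\<close>

lemma fib_square_convolution:
  "int (fib (m + 3)) ^ 2 = int (C (m + 2)) + (\<Sum>j\<le>m. fib_weight j * int (C (m - j)))"
proof (induction m rule: less_induct)
  case (less m)
  define S where "S m = (\<Sum>j\<le>m. fib_weight j * int (C (m - j)))" for m
  have C3: "C 3 = 6" and C4: "C 4 = 13"
    using C_rec[of 0] C_rec[of 1] C_0 C_1 C_2 by (simp_all add: eval_nat_numeral)
  consider "m = 0" | "m = 1" | "m = 2" | k where "m = k + 3"
    using le_Suc_ex[of 3 m] by (cases "m < 3") (force simp: add.commute)+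
  then show ?case
  proof cases
    case 1
    then show ?thesis using C_0 C_2 by (simp add: fib_weight_def eval_nat_numeral)
  next
    case 2
    then show ?thesis using C_0 C_1 C3
      by (simp add: fib_weight_def eval_nat_numeral)
  next
    case 3
    then show ?thesis using C_0 C_1 C_2 C4
      by (simp add: fib_weight_def eval_nat_numeral)
  next
    case 4
    have S: "S (k + 3) = S (k + 2) + 2 * S (k + 1) + S k + fib_weight (k + 3)"
      unfolding S_def using C_0 C_1 C_2 C_rec
      by (intro convolution_rec) auto
    have shift: "k + 2 + 3 = k + 5" "k + 2 + 2 = k + 4" "k + 2 + 1 = k + 3" "k + 1 + 3 = k + 4"
      "k + 1 + 2 = k + 3" "k + 3 + 3 = k + 6" "k + 3 + 2 = k + 5" "k + 3 + 1 = k + 4"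
      by simp_all
    have C: "C (k + 5) = C (k + 4) + 2 * C (k + 3) + C (k + 2)"
      using C_rec[of "k + 2"] unfolding shift .
    have "int (fib (i + 3)) ^ 2 = int (C (i + 2)) + S i" if "i < m" for i
      using less[OF that] unfolding S_def .
    from this[of "k + 2"] this[of "k + 1"] this[of k]
    have ih: "int (fib (k + 5)) ^ 2 = int (C (k + 4)) + S (k + 2)"
      "int (fib (k + 4)) ^ 2 = int (C (k + 3)) + S (k + 1)"
      "int (fib (k + 3)) ^ 2 = int (C (k + 2)) + S k"
      unfolding 4 shift by simp_all
    have "fib (k + 6) = fib (k + 5) + fib (k + 4)" "fib (k + 5) = fib (k + 4) + fib (k + 3)"
      by (simp_all add: eval_nat_numeral)
    \<comment> \<open>Squaring the first relation gives the product of \<open>fib (k + 5)\<close>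
      and \<open>fib (k + 4)\<close>, which the second relation expands; the square of
      \<open>fib (k + 3)\<close> cancels against the one in the weight.\<close>
    then have "int (fib (k + 6)) ^ 2 = int (fib (k + 5)) ^ 2 + 2 * int (fib (k + 4)) ^ 2
        + int (fib (k + 3)) ^ 2 + fib_weight (k + 3)"
      unfolding fib_weight_def shift by (simp add: power2_eq_square algebra_simps)
    then show ?thesis using ih S C unfolding 4 shift S_def[symmetric] by simp
  qed
qed

theorem mainTheorem6:
  fixes n :: nat
  shows "int (fib (n + 1)) ^ 2 =
    int (C n)
    + (\<Sum>k = 2..n. int (fib (k - 1)) ^ 2 * int (C (n - k)))
    + (\<Sum>k = 3..n. \<Sum>l = 3..k.
         (2 - (if l = 3 then 1 else 0)) * int (fib (k - l + 1)) ^ 2 * int (C (n - k)))"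
proof (cases "n < 2")
  case True
  \<comment> \<open>The sums are empty and both sides are 1.\<close>
  then have "n = 0 \<or> n = 1" by auto
  then show ?thesis using C_0 C_1 by auto
next
  case False
  then obtain m where n: "n = m + 2" by (metis add.commute le_Suc_ex not_less)
  let ?w = "\<lambda>k l. (2 - (if l = 3 then 1 else 0)) * int (fib (k - l + 1)) ^ 2 :: int"
  \<comment> \<open>The inner sum for \<open>k = 2\<close> is empty, so both outer sums can run from
    2 and be merged.\<close>
  have "(\<Sum>k = 3..n. \<Sum>l = 3..k. ?w k l * int (C (n - k)))
      = (\<Sum>k = 2..n. \<Sum>l = 3..k. ?w k l * int (C (n - k)))"
    using False by (intro sum.mono_neutral_left) auto
  then have "(\<Sum>k = 2..n. int (fib (k - 1)) ^ 2 * int (C (n - k)))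
      + (\<Sum>k = 3..n. \<Sum>l = 3..k. ?w k l * int (C (n - k)))
      = (\<Sum>k = 2..n. (int (fib (k - 1)) ^ 2 + (\<Sum>l = 3..k. ?w k l)) * int (C (n - k)))"
    by (simp add: sum.distrib sum_distrib_right distrib_right)
  \<comment> \<open>Shift the index by \<open>k = j + 2\<close>.\<close>
  also have "\<dots> = (\<Sum>j\<le>m. (int (fib (j + 2 - 1)) ^ 2 + (\<Sum>l = 3..j + 2. ?w (j + 2) l))
      * int (C (n - (j + 2))))"
    using sum.shift_bounds_cl_nat_ivl[of _ 0 2 m] by (simp only: n atMost_atLeast0 add_0)
  also have "\<dots> = (\<Sum>j\<le>m. fib_weight j * int (C (m - j)))"
  proof (rule sum.cong)
    fix j
    have "j + 2 - 1 = j + 1" "n - (j + 2) = m - j" using n by simp_all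
    then show "(int (fib (j + 2 - 1)) ^ 2 + (\<Sum>l = 3..j + 2. ?w (j + 2) l)) * int (C (n - (j + 2)))
        = fib_weight j * int (C (m - j))"
      by (simp only: sum_eq_fib_weight)
  qed simp
  finally show ?thesis
    using fib_square_convolution[of m] by (simp add: n eval_nat_numeral)
qed

end
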